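(* The set of extreme points of the closed unit ball $\mathcal{Y}^*_1$ of the dual space $\mathcal{Y}^*$ is $$\mathrm{ext}(\mathcal{Y}^*_1)=\{e^{i\theta}\delta_z:\ z\in\triangle,\ \theta\in\mathbb{R}\}.$$
   Context: $\triangle=\{z\in\mathbb{C}:|z|<1\}$ is the open unit disc. The Zygmund space $\mathcal{Z}$ is the set of all analytic functions $f:\triangle\to\mathbb{C}$ that extend continuously to the boundary of $\triangle$ and satisfy $\sup_{|z|<1}(1-|z|^2)|f''(z)|<\infty$, with norm $\|f\|_{\mathcal{Z}}=|f(0)|+|f'(0)|+\sup_{|z|<1}(1-|z|^2)|f''(z)|$. The little Zygmund space is $\mathcal{Z}_0=\{f\in\mathcal{Z}:\lim_{|z|\to1^-}(1-|z|^2)|f''(z)|=0\}$, and $\mathcal{Z}_0^{(0,1)}=\{f\in\mathcal{Z}_0: f(0)=f'(0)=0\}$, with the inherited norm. $\mathcal{C}_0(\triangle)$ is the space of continuous functions $F:\triangle\to\mathbb{C}$ with $\lim_{|z|\to1}F(z)=0$, with norm $\|F\|_\infty=\max_{z\in\triangle}|F(z)|$. The map $\Phi:\mathcal{Z}_0^{(0,1)}\to\mathcal{C}_0(\triangle)$, $\Phi(f)(z)=(1-|z|^2)f''(z)$, is a linear isometry, and $\mathcal{Y}\subseteq\mathcal{C}_0(\triangle)$ denotes its range, with the norm $\|\cdot\|_\infty$. For $z\in\triangle$, $\delta_z:\mathcal{Y}\to\mathbb{C}$ is the evaluation functional $\delta_z(F)=F(z)$. *)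

theory Defs
  imports "HOL-Complex_Analysis.Complex_Analysis"
begin

abbreviation unit_disc :: "complex set" (\<open>\<triangle>\<close>)
  where "\<triangle> \<equiv> ball 0 1"

abbreviation to_circle :: "complex filter"
  where "to_circle \<equiv> filtercomap norm (at_left 1)"

text \<open>
  A limit along \<open>to_circle\<close> is a limit as \<open>norm z\<close> tends to \<open>1\<close> from below, uniformly in the argument.

  Functions on the disc are represented by total functions on the complex plane. No
  condition is put on the values of a member of \<open>zygmund\<close> outside the disc; they are
  ignored by everything below.
\<close>

definition zygmund :: "(complex \<Rightarrow> complex) set" where
  "zygmund = {f. f holomorphic_on \<triangle> \<and>
     (\<exists>g. continuous_on (closure \<triangle>) g \<and> (\<forall>z\<in>\<triangle>. g z = f z)) \<and>
     bdd_above ((\<lambda>z. (1 - (norm z)\<^sup>2) * norm ((deriv ^^ 2) f z)) ` \<triangle>)}"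

definition little_zygmund :: "(complex \<Rightarrow> complex) set" where
  "little_zygmund = {f \<in> zygmund.
     ((\<lambda>z. (1 - (norm z)\<^sup>2) * norm ((deriv ^^ 2) f z)) \<longlongrightarrow> 0) to_circle}"

definition little_zygmund01 :: "(complex \<Rightarrow> complex) set" where
  "little_zygmund01 = {f \<in> little_zygmund. f 0 = 0 \<and> deriv f 0 = 0}"

text \<open>
  Here, in contrast, the value outside the disc is fixed to be \<open>0\<close>, so that equality of
  members of \<open>C0_disc\<close> is equality on the disc.
\<close>

definition C0_disc :: "(complex \<Rightarrow> complex) set" where
  "C0_disc = {F. continuous_on \<triangle> F \<and> (F \<longlongrightarrow> 0) to_circle \<and> (\<forall>z. z \<notin> \<triangle> \<longrightarrow> F z = 0)}"

definition Phi :: "(complex \<Rightarrow> complex) \<Rightarrow> complex \<Rightarrow> complex" where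
  "Phi f = (\<lambda>z. if z \<in> \<triangle> then of_real (1 - (norm z)\<^sup>2) * (deriv ^^ 2) f z else 0)"

lemma holomorphic_deriv2: "f holomorphic_on \<triangle> \<Longrightarrow> (deriv ^^ 2) f holomorphic_on \<triangle>"
  by (simp add: holomorphic_higher_deriv)

lemma norm_sq_disc_le: "z \<in> \<triangle> \<Longrightarrow> (norm z)\<^sup>2 \<le> 1"
  by (simp add: abs_square_le_1)

lemma norm_Phi: "z \<in> \<triangle> \<Longrightarrow> norm (Phi f z) = (1 - (norm z)\<^sup>2) * norm ((deriv ^^ 2) f z)"
  using norm_sq_disc_le[of z] by (simp add: Phi_def norm_mult del: of_real_diff)

lemma norm_Phi_image:
  "(\<lambda>z. norm (Phi f z)) ` \<triangle> = (\<lambda>z. (1 - (norm z)\<^sup>2) * norm ((deriv ^^ 2) f z)) ` \<triangle>"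
  by (rule image_cong) (simp_all add: norm_Phi del: mem_ball_0)

lemma eventually_to_circle: "\<forall>\<^sub>F z in to_circle. z \<in> \<triangle>"
  by (auto simp: eventually_filtercomap intro!: exI[of _ "\<lambda>x. x < 1"] eventually_at_leftI[of 0])

lemma Phi_in_C0:
  assumes "f \<in> little_zygmund"
  shows "Phi f \<in> C0_disc"
proof -
  have hol: "f holomorphic_on \<triangle>" and lim:
    "((\<lambda>z. (1 - (norm z)\<^sup>2) * norm ((deriv ^^ 2) f z)) \<longlongrightarrow> 0) to_circle"
    using assms by (auto simp: little_zygmund_def zygmund_def)
  have "continuous_on \<triangle> (\<lambda>z. of_real (1 - (norm z)\<^sup>2) * (deriv ^^ 2) f z)"
    by (intro continuous_intros holomorphic_on_imp_continuous_on holomorphic_deriv2 hol)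
  then have c: "continuous_on \<triangle> (Phi f)"
    by (rule continuous_on_eq) (simp add: Phi_def)
  have "((\<lambda>z. norm (Phi f z)) \<longlongrightarrow> 0) to_circle"
    by (rule Lim_transform_eventually[OF lim])
      (auto intro: eventually_mono[OF eventually_to_circle] simp: norm_Phi)
  then have "(Phi f \<longlongrightarrow> 0) to_circle"
    by (simp add: tendsto_norm_zero_iff)
  with c show ?thesis by (auto simp: C0_disc_def Phi_def)
qed

lemma bdd_above_norm_Phi:
  assumes "f \<in> little_zygmund01"
  shows "bdd_above ((\<lambda>z. norm (Phi f z)) ` \<triangle>)"
proof -
  have "bdd_above ((\<lambda>z. (1 - (norm z)\<^sup>2) * norm ((deriv ^^ 2) f z)) ` \<triangle>)"
    using assms by (auto simp: little_zygmund01_def little_zygmund_def zygmund_def)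
  then show ?thesis by (simp only: norm_Phi_image)
qed

lemma little_zygmund01_iff:
  "f \<in> little_zygmund01 \<longleftrightarrow> f holomorphic_on \<triangle> \<and>
     (\<exists>g. continuous_on (closure \<triangle>) g \<and> (\<forall>z\<in>\<triangle>. g z = f z)) \<and>
     bdd_above ((\<lambda>z. norm (Phi f z)) ` \<triangle>) \<and> (Phi f \<longlongrightarrow> 0) to_circle \<and>
     f 0 = 0 \<and> deriv f 0 = 0"
proof -
  have "bdd_above ((\<lambda>z. norm (Phi f z)) ` \<triangle>) \<longleftrightarrow>
      bdd_above ((\<lambda>z. (1 - (norm z)\<^sup>2) * norm ((deriv ^^ 2) f z)) ` \<triangle>)"
    by (simp only: norm_Phi_image)
  moreover have "(Phi f \<longlongrightarrow> 0) to_circle \<longleftrightarrow>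
      ((\<lambda>z. (1 - (norm z)\<^sup>2) * norm ((deriv ^^ 2) f z)) \<longlongrightarrow> 0) to_circle"
    unfolding tendsto_norm_zero_iff[symmetric, of "Phi f"]
    by (rule tendsto_cong) (auto intro: eventually_mono[OF eventually_to_circle] simp: norm_Phi)
  ultimately show ?thesis
    by (auto simp: little_zygmund01_def little_zygmund_def zygmund_def)
qed

lemma higher_deriv_add_disc:
  assumes "f holomorphic_on \<triangle>" "g holomorphic_on \<triangle>" "z \<in> \<triangle>"
  shows "(deriv ^^ n) (\<lambda>w. f w + g w) z = (deriv ^^ n) f z + (deriv ^^ n) g z"
  using assms by (intro higher_deriv_add) auto

lemma higher_deriv_cmult_disc:
  assumes "f holomorphic_on \<triangle>" "z \<in> \<triangle>"
  shows "(deriv ^^ n) (\<lambda>w. c * f w) z = c * (deriv ^^ n) f z"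
  using assms by (intro higher_deriv_cmult[where A = \<triangle>]) auto

lemma Phi_zero: "Phi (\<lambda>z. 0) = (\<lambda>z. 0)"
  by (simp add: Phi_def fun_eq_iff numeral_2_eq_2)

lemma Phi_add:
  assumes "f holomorphic_on \<triangle>" "g holomorphic_on \<triangle>"
  shows "Phi (\<lambda>z. f z + g z) = (\<lambda>z. Phi f z + Phi g z)"
  using assms by (auto simp: Phi_def fun_eq_iff higher_deriv_add_disc distrib_left)

lemma Phi_cmult:
  assumes "f holomorphic_on \<triangle>"
  shows "Phi (\<lambda>z. c * f z) = (\<lambda>z. c * Phi f z)"
  using assms by (auto simp: Phi_def fun_eq_iff higher_deriv_cmult_disc)

lemma zero_in_lz: "(\<lambda>z. 0) \<in> little_zygmund01"
  by (auto simp: little_zygmund01_iff Phi_zero intro!: exI[of _ "\<lambda>z. 0"])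

lemma add_in_lz:
  assumes f: "f \<in> little_zygmund01" and g: "g \<in> little_zygmund01"
  shows "(\<lambda>z. f z + g z) \<in> little_zygmund01"
proof -
  have hol: "f holomorphic_on \<triangle>" "g holomorphic_on \<triangle>"
    using f g by (auto simp: little_zygmund01_iff)
  obtain f' g' where fg': "continuous_on (closure \<triangle>) f'" "\<forall>z\<in>\<triangle>. f' z = f z"
      "continuous_on (closure \<triangle>) g'" "\<forall>z\<in>\<triangle>. g' z = g z"
    using f g by (auto simp: little_zygmund01_iff)
  have ext: "\<exists>h. continuous_on (closure \<triangle>) h \<and> (\<forall>z\<in>\<triangle>. h z = f z + g z)"
    by (rule exI[of _ "\<lambda>z. f' z + g' z"]) (use fg' in \<open>auto intro!: continuous_intros\<close>)
  obtain a b where "\<forall>z\<in>\<triangle>. norm (Phi f z) \<le> a" "\<forall>z\<in>\<triangle>. norm (Phi g z) \<le> b"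
    using f g by (auto simp: little_zygmund01_iff bdd_above_def)
  then have bdd: "bdd_above ((\<lambda>z. norm (Phi f z + Phi g z)) ` \<triangle>)"
    by (intro bdd_aboveI2[of _ _ "a + b"]) (meson add_mono norm_triangle_ineq order_trans)
  have lim: "((\<lambda>z. Phi f z + Phi g z) \<longlongrightarrow> 0) to_circle"
    using f g by (auto simp: little_zygmund01_iff intro: tendsto_add_zero)
  have "deriv (\<lambda>z. f z + g z) 0 = 0"
    using higher_deriv_add_disc[OF hol, of 0 1] f g by (simp add: little_zygmund01_iff)
  then show ?thesis
    using hol ext bdd lim f g
    by (auto simp: little_zygmund01_iff Phi_add[OF hol] intro!: holomorphic_intros)
qed

lemma cmult_in_lz:
  assumes f: "f \<in> little_zygmund01"
  shows "(\<lambda>z. c * f z) \<in> little_zygmund01"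
proof -
  have hol: "f holomorphic_on \<triangle>"
    using f by (auto simp: little_zygmund01_iff)
  obtain f' where f': "continuous_on (closure \<triangle>) f'" "\<forall>z\<in>\<triangle>. f' z = f z"
    using f by (auto simp: little_zygmund01_iff)
  have ext: "\<exists>h. continuous_on (closure \<triangle>) h \<and> (\<forall>z\<in>\<triangle>. h z = c * f z)"
    by (rule exI[of _ "\<lambda>z. c * f' z"]) (use f' in \<open>auto intro!: continuous_intros\<close>)
  obtain a where "\<forall>z\<in>\<triangle>. norm (Phi f z) \<le> a"
    using f by (auto simp: little_zygmund01_iff bdd_above_def)
  then have bdd: "bdd_above ((\<lambda>z. norm (c * Phi f z)) ` \<triangle>)"
    by (intro bdd_aboveI2[of _ _ "norm c * a"]) (simp add: norm_mult mult_left_mono)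
  have lim: "((\<lambda>z. c * Phi f z) \<longlongrightarrow> 0) to_circle"
    using f by (auto simp: little_zygmund01_iff intro: tendsto_mult_right_zero)
  have "deriv (\<lambda>z. c * f z) 0 = 0"
    using higher_deriv_cmult_disc[OF hol, of 0 1] f by (simp add: little_zygmund01_iff)
  then show ?thesis
    using hol ext bdd lim f
    by (auto simp: little_zygmund01_iff Phi_cmult[OF hol] intro!: holomorphic_intros)
qed

definition Y_set :: "(complex \<Rightarrow> complex) set" where
  "Y_set = Phi ` little_zygmund01"

lemma Y_set_subset_C0: "Y_set \<subseteq> C0_disc"
  by (auto simp: Y_set_def little_zygmund01_def intro: Phi_in_C0)

lemma zero_in_Y: "(\<lambda>z. 0) \<in> Y_set"
  unfolding Y_set_def using zero_in_lz Phi_zero by (metis imageI)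

lemma add_in_Y:
  assumes "F \<in> Y_set" "G \<in> Y_set"
  shows "(\<lambda>z. F z + G z) \<in> Y_set"
proof -
  obtain f g where fg: "f \<in> little_zygmund01" "g \<in> little_zygmund01" "F = Phi f" "G = Phi g"
    using assms by (auto simp: Y_set_def)
  then have "(\<lambda>z. F z + G z) = Phi (\<lambda>z. f z + g z)"
    by (simp add: Phi_add little_zygmund01_iff)
  with add_in_lz[OF fg(1,2)] show ?thesis by (auto simp: Y_set_def)
qed

lemma cmult_in_Y:
  assumes "F \<in> Y_set"
  shows "(\<lambda>z. c * F z) \<in> Y_set"
proof -
  obtain f where f: "f \<in> little_zygmund01" "F = Phi f"
    using assms by (auto simp: Y_set_def)
  then have "(\<lambda>z. c * F z) = Phi (\<lambda>z. c * f z)"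
    by (simp add: Phi_cmult little_zygmund01_iff)
  with cmult_in_lz[OF f(1)] show ?thesis by (auto simp: Y_set_def)
qed

lemma uminus_in_Y: "F \<in> Y_set \<Longrightarrow> (\<lambda>z. - F z) \<in> Y_set"
  using cmult_in_Y[of F "-1"] by simp

lemma minus_in_Y: "F \<in> Y_set \<Longrightarrow> G \<in> Y_set \<Longrightarrow> (\<lambda>z. F z - G z) \<in> Y_set"
  using add_in_Y[OF _ uminus_in_Y, of F G] by simp

lemma scaleR_in_Y: "F \<in> Y_set \<Longrightarrow> (\<lambda>z. r *\<^sub>R F z) \<in> Y_set"
  using cmult_in_Y[of F "of_real r"] by (simp add: scaleR_conv_of_real)

lemma bdd_above_Y: "F \<in> Y_set \<Longrightarrow> bdd_above ((\<lambda>z. norm (F z)) ` \<triangle>)"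
  by (auto simp: Y_set_def bdd_above_norm_Phi)

lemma Y_outside: "F \<in> Y_set \<Longrightarrow> z \<notin> \<triangle> \<Longrightarrow> F z = 0"
  using Y_set_subset_C0 by (auto simp: C0_disc_def)

typedef Y = Y_set
  morphisms apply_Y Abs_Y
  using zero_in_Y by blast

setup_lifting type_definition_Y

instantiation Y :: real_normed_vector
begin

lift_definition zero_Y :: Y is "\<lambda>z. 0" by (rule zero_in_Y)
lift_definition plus_Y :: "Y \<Rightarrow> Y \<Rightarrow> Y" is "\<lambda>F G z. F z + G z" by (rule add_in_Y)
lift_definition minus_Y :: "Y \<Rightarrow> Y \<Rightarrow> Y" is "\<lambda>F G z. F z - G z" by (rule minus_in_Y)
lift_definition uminus_Y :: "Y \<Rightarrow> Y" is "\<lambda>F z. - F z" by (rule uminus_in_Y)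
lift_definition scaleR_Y :: "real \<Rightarrow> Y \<Rightarrow> Y" is "\<lambda>r F z. r *\<^sub>R F z" by (rule scaleR_in_Y)
lift_definition norm_Y :: "Y \<Rightarrow> real" is "\<lambda>F. SUP z\<in>\<triangle>. norm (F z)" .

definition sgn_Y :: "Y \<Rightarrow> Y" where "sgn_Y F = scaleR (inverse (norm F)) F"
definition dist_Y :: "Y \<Rightarrow> Y \<Rightarrow> real" where "dist_Y F G = norm (F - G)"
definition uniformity_Y :: "(Y \<times> Y) filter" where
  "uniformity_Y = (INF e\<in>{0<..}. principal {(F, G). dist F G < e})"
definition open_Y :: "Y set \<Rightarrow> bool" where
  "open_Y S = (\<forall>F\<in>S. \<forall>\<^sub>F (F', G) in uniformity. F' = F \<longrightarrow> G \<in> S)"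

instance
proof
  fix F G :: Y and r :: real
  show "norm F = 0 \<longleftrightarrow> F = 0"
  proof transfer
    fix F assume F: "F \<in> Y_set"
    show "(SUP z\<in>\<triangle>. norm (F z)) = 0 \<longleftrightarrow> F = (\<lambda>z. 0)"
    proof
      assume *: "(SUP z\<in>\<triangle>. norm (F z)) = 0"
      have "F z = 0" for z
      proof (cases "z \<in> \<triangle>")
        case True
        then show ?thesis using cSUP_upper[OF True bdd_above_Y[OF F]] * by simp
      qed (simp add: Y_outside[OF F])
      then show "F = (\<lambda>z. 0)" by auto
    qed simp
  qed
  show "norm (F + G) \<le> norm F + norm G"
  proof transfer
    fix F G assume F: "F \<in> Y_set" and G: "G \<in> Y_set"
    show "(SUP z\<in>\<triangle>. norm (F z + G z)) \<le> (SUP z\<in>\<triangle>. norm (F z)) + (SUP z\<in>\<triangle>. norm (G z))"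
    proof (rule cSUP_least)
      fix z :: complex assume z: "z \<in> \<triangle>"
      show "norm (F z + G z) \<le> (SUP z\<in>\<triangle>. norm (F z)) + (SUP z\<in>\<triangle>. norm (G z))"
        using cSUP_upper[OF z bdd_above_Y[OF F]] cSUP_upper[OF z bdd_above_Y[OF G]]
          norm_triangle_ineq[of "F z" "G z"] by linarith
    qed simp
  qed
  show "norm (r *\<^sub>R F) = \<bar>r\<bar> * norm F"
  proof transfer
    fix r :: real and F assume F: "F \<in> Y_set"
    have "(SUP z\<in>\<triangle>. \<bar>r\<bar> * norm (F z)) = \<bar>r\<bar> * (SUP z\<in>\<triangle>. norm (F z))"
    proof (rule antisym)
      show "(SUP z\<in>\<triangle>. \<bar>r\<bar> * norm (F z)) \<le> \<bar>r\<bar> * (SUP z\<in>\<triangle>. norm (F z))"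
        by (rule cSUP_least) (auto intro!: mult_left_mono cSUP_upper bdd_above_Y[OF F])
      have bdd: "bdd_above ((\<lambda>z. \<bar>r\<bar> * norm (F z)) ` \<triangle>)"
        using bdd_above_Y[OF scaleR_in_Y[OF F, of r]] by simp
      show "\<bar>r\<bar> * (SUP z\<in>\<triangle>. norm (F z)) \<le> (SUP z\<in>\<triangle>. \<bar>r\<bar> * norm (F z))"
      proof (cases "r = 0")
        case False
        have "(SUP z\<in>\<triangle>. norm (F z)) \<le> (SUP z\<in>\<triangle>. \<bar>r\<bar> * norm (F z)) / \<bar>r\<bar>"
        proof (rule cSUP_least)
          fix z :: complex assume "z \<in> \<triangle>"
          from cSUP_upper[OF this bdd] False
          show "norm (F z) \<le> (SUP z\<in>\<triangle>. \<bar>r\<bar> * norm (F z)) / \<bar>r\<bar>"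
            by (simp add: field_simps)
        qed simp
        with False show ?thesis by (simp add: field_simps)
      qed simp
    qed
    then show "(SUP z\<in>\<triangle>. norm (r *\<^sub>R F z)) = \<bar>r\<bar> * (SUP z\<in>\<triangle>. norm (F z))" by simp
  qed
qed (transfer; simp add: algebra_simps fun_eq_iff sgn_Y_def dist_Y_def uniformity_Y_def open_Y_def)+

end

lift_definition scaleC_Y :: "complex \<Rightarrow> Y \<Rightarrow> Y" (infixr \<open>*\<^sub>Y\<close> 75)
  is "\<lambda>c F z. c * F z" by (rule cmult_in_Y)

lemma norm_Y_ge: "norm (apply_Y F z) \<le> norm F"
proof (cases "z \<in> \<triangle>")
  case True
  then show ?thesis by transfer (auto intro: cSUP_upper bdd_above_Y)
next
  case False
  then have "apply_Y F z = 0" by transfer (rule Y_outside)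
  then show ?thesis by simp
qed

text \<open>
  Bounded linear operators in the library are linear over the reals, so the dual of the complex
  space \<open>Y\<close> consists of the complex linear ones among them. Its norm is the operator norm.
\<close>

definition dual_Y :: "(Y \<Rightarrow>\<^sub>L complex) set" where
  "dual_Y = {\<phi>. \<forall>c F. blinfun_apply \<phi> (c *\<^sub>Y F) = c * blinfun_apply \<phi> F}"

definition dual_ball_Y :: "(Y \<Rightarrow>\<^sub>L complex) set" where
  "dual_ball_Y = {\<phi> \<in> dual_Y. norm \<phi> \<le> 1}"

definition scaleC_dual :: "complex \<Rightarrow> (Y \<Rightarrow>\<^sub>L complex) \<Rightarrow> (Y \<Rightarrow>\<^sub>L complex)" (infixr \<open>*\<^sub>D\<close> 75)
  where "c *\<^sub>D \<phi> = Blinfun (\<lambda>F. c * blinfun_apply \<phi> F)"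

lemma scaleC_dual_apply [simp]: "blinfun_apply (c *\<^sub>D \<phi>) F = c * blinfun_apply \<phi> F"
  unfolding scaleC_dual_def
  by (subst bounded_linear_Blinfun_apply)
    (auto intro: bounded_linear_const_mult blinfun.bounded_linear_right)

definition delta :: "complex \<Rightarrow> (Y \<Rightarrow>\<^sub>L complex)" (\<open>\<delta>\<close>)
  where "\<delta> z = Blinfun (\<lambda>F. apply_Y F z)"

lemma delta_apply [simp]: "blinfun_apply (\<delta> z) F = apply_Y F z"
proof -
  have "bounded_linear (\<lambda>F. apply_Y F z)"
    by (rule bounded_linear_intro[where K = 1])
      (auto simp: plus_Y.rep_eq scaleR_Y.rep_eq norm_Y_ge)
  then show ?thesis
    by (simp add: delta_def bounded_linear_Blinfun_apply)
qed

end

theory Submission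
  imports Defs
begin

text \<open>
  For \<open>a\<close> in the disc, \<open>P z = (1 - |z|\<^sup>2) (1 - |a|\<^sup>2) / (1 - cnj a z)\<^sup>2\<close> lies in \<open>Y\<close> and peaks at \<open>a\<close>. If
  a functional of norm at most \<open>1\<close> attains modulus \<open>1\<close> at \<open>P\<close>, then testing it on \<open>P + \<epsilon> G\<close> with
  \<open>G a = 0\<close> shows that it vanishes at every such \<open>G\<close>; hence it is a multiple of \<open>\<delta> a\<close>, and the
  unimodular multiples of \<open>\<delta> a\<close> are extreme.

  Conversely, say that \<open>\<phi>\<close> is carried by a set \<open>A\<close> if \<open>|\<phi> F|\<close> is at most the supremum of \<open>|F|\<close> over \<open>A\<close>. If \<open>\<phi>\<close> is
  carried by \<open>A \<union> B\<close>, the Hahn-Banach theorem splits it as \<open>\<phi>1 + \<phi>2\<close> with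
  \<open>|\<phi>1 F| + |\<phi>2 G| \<le> max (sup_on A F) (sup_on B G)\<close>. An extreme \<open>\<phi>\<close> must be proportional to both parts,
  so it is already carried by \<open>A\<close> or by \<open>B\<close>, and likewise for finite unions. Now suppose that for every point \<open>a\<close> of
  the disc some \<open>G\<close> has \<open>G a = 0\<close> and \<open>\<phi> G \<noteq> 0\<close>. By compactness, and because members of \<open>Y\<close> tend to \<open>0\<close> at the
  circle, finitely many sets of the form \<open>{z. |G z| < |\<phi> G| / 2}\<close> cover the disc, but
  none of them carries \<open>\<phi>\<close>. So some point \<open>a\<close> satisfies \<open>G a = 0 \<Longrightarrow> \<phi> G = 0\<close>, and \<open>\<phi>\<close> is a multiple of \<open>\<delta> a\<close>.
\<close>

section \<open>Sublinear functionals\<close>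

definition sublinear :: "('a::real_vector \<Rightarrow> real) \<Rightarrow> bool" where
  "sublinear p \<longleftrightarrow> (\<forall>x y. p (x + y) \<le> p x + p y) \<and> (\<forall>r x. 0 \<le> r \<longrightarrow> p (r *\<^sub>R x) = r * p x)"

lemma sublinear_add: "sublinear p \<Longrightarrow> p (x + y) \<le> p x + p y"
  by (simp add: sublinear_def)

lemma sublinear_scaleR: "sublinear p \<Longrightarrow> 0 \<le> r \<Longrightarrow> p (r *\<^sub>R x) = r * p x"
  by (simp add: sublinear_def)

lemma sublinear_zero: "sublinear p \<Longrightarrow> p 0 = 0"
  using sublinear_scaleR[of p 0 0] by simp

lemma sublinear_ge_uminus: "sublinear p \<Longrightarrow> - p (- x) \<le> p x"
  using sublinear_add[of p x "- x"] by (simp add: sublinear_zero)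

text \<open>The reverse inequality for \<open>r > 0\<close> comes from \<open>scale\<close> at
  \<open>inverse r\<close>. At \<open>r = 0\<close>, subadditivity gives
  \<open>0 \<le> p 0\<close>.\<close>

lemma sublinearI:
  assumes add: "\<And>x y. p (x + y) \<le> p x + p y" and zero: "p 0 \<le> 0"
    and scale: "\<And>r x. 0 < r \<Longrightarrow> p (r *\<^sub>R x) \<le> r * p x"
  shows "sublinear p"
  unfolding sublinear_def
proof (intro conjI allI impI)
  fix r :: real and x assume "0 \<le> r"
  show "p (r *\<^sub>R x) = r * p x"
  proof (cases "r = 0")
    case True
    then show ?thesis using zero add[of 0 0] by simp
  next
    case False
    with \<open>0 \<le> r\<close> have r: "0 < r" by simp
    have "p x \<le> inverse r * p (r *\<^sub>R x)"
      using scale[of "inverse r" "r *\<^sub>R x"] r by simp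
    then have "r * p x \<le> p (r *\<^sub>R x)"
      using r by (simp add: field_simps)
    with scale[OF r, of x] show ?thesis by simp
  qed
qed (rule add)

text \<open>Minimising a jointly sublinear \<open>P\<close> over a convex cone \<open>K\<close>
  keeps sublinearity. The lower bound \<open>m x\<close> makes each infimum a genuine one in the
  reals. The cone is a half-line in the next lemma and the whole space in the splitting of a
  functional.\<close>

lemma sublinear_INF:
  fixes P :: "'a::real_vector \<Rightarrow> 'b::real_vector \<Rightarrow> real"
  assumes K: "0 \<in> K" "\<And>k l. k \<in> K \<Longrightarrow> l \<in> K \<Longrightarrow> k + l \<in> K"
      "\<And>r k. 0 < r \<Longrightarrow> k \<in> K \<Longrightarrow> r *\<^sub>R k \<in> K"
    and add: "\<And>x y k l. P (x + y) (k + l) \<le> P x k + P y l"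
    and scale: "\<And>r x k. 0 \<le> r \<Longrightarrow> P (r *\<^sub>R x) (r *\<^sub>R k) = r * P x k"
    and bdd: "\<And>x k. k \<in> K \<Longrightarrow> m x \<le> P x k"
  shows "sublinear (\<lambda>x. INF k\<in>K. P x k)"
proof -
  have lower: "(INF k\<in>K. P x k) \<le> P x k" if "k \<in> K" for x k
    by (rule cINF_lower[OF bdd_belowI2[of _ "m x"] that]) (rule bdd)
  have ne: "K \<noteq> {}" using K(1) by auto
  show ?thesis
  proof (rule sublinearI)
    fix x y
    have "(INF k\<in>K. P (x + y) k) - (INF l\<in>K. P y l) \<le> P x k" if k: "k \<in> K" for k
    proof -
      have "(INF k\<in>K. P (x + y) k) - P x k \<le> P y l" if "l \<in> K" for l
        using lower[OF K(2)[OF k that], of "x + y"] add[of x y k l] by linarith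
      then have "(INF k\<in>K. P (x + y) k) - P x k \<le> (INF l\<in>K. P y l)"
        by (rule cINF_greatest[OF ne])
      then show ?thesis by linarith
    qed
    then have "(INF k\<in>K. P (x + y) k) - (INF l\<in>K. P y l) \<le> (INF k\<in>K. P x k)"
      by (rule cINF_greatest[OF ne])
    then show "(INF k\<in>K. P (x + y) k) \<le> (INF k\<in>K. P x k) + (INF k\<in>K. P y k)" by linarith
  next
    show "(INF k\<in>K. P 0 k) \<le> 0"
      using lower[OF K(1), of 0] scale[of 0 0 0] by simp
  next
    fix r :: real and x assume r: "0 < r"
    have "(INF k\<in>K. P (r *\<^sub>R x) k) / r \<le> P x k" if "k \<in> K" for k
      using lower[OF K(3)[OF r that], of "r *\<^sub>R x"] scale[of r x k] r
      by (simp add: field_simps)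
    then have "(INF k\<in>K. P (r *\<^sub>R x) k) / r \<le> (INF k\<in>K. P x k)"
      by (rule cINF_greatest[OF ne])
    then show "(INF k\<in>K. P (r *\<^sub>R x) k) \<le> r * (INF k\<in>K. P x k)"
      using r by (simp add: field_simps)
  qed
qed

text \<open>Together with Zorn's lemma, this takes the place of the one-dimensional extension step
  in the usual proof of Hahn-Banach.\<close>

lemma minimal_sublinear_imp_linear:
  assumes q: "sublinear q" and min: "\<And>q'. sublinear q' \<Longrightarrow> q' \<le> q \<Longrightarrow> q' = q"
  shows "linear q"
proof -
  have add: "q (x + y) = q x + q y" for x y
  proof -
    \<comment> \<open>\<open>q'\<close> is sublinear and at most \<open>q\<close>; by minimality \<open>q' = q\<close>, and \<open>t = 1\<close> then gives \<open>q x + q y \<le> q (x + y)\<close>.\<close>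
    define q' where "q' = (\<lambda>x. INF t\<in>{0..}. q (x + t *\<^sub>R y) - t * q y)"
    have bdd: "- q (- x) \<le> q (x + t *\<^sub>R y) - t * q y" if "t \<in> {0..}" for t x
      using sublinear_add[OF q, of "- x" "x + t *\<^sub>R y"] sublinear_scaleR[OF q, of t y] that by simp
    have "sublinear q'"
      unfolding q'_def
    proof (rule sublinear_INF[where m = "\<lambda>x. - q (- x)"])
      fix x x' and t s :: real
      have "x + x' + (t + s) *\<^sub>R y = (x + t *\<^sub>R y) + (x' + s *\<^sub>R y)"
        by (simp add: algebra_simps)
      then show "q (x + x' + (t + s) *\<^sub>R y) - (t + s) * q y
          \<le> q (x + t *\<^sub>R y) - t * q y + (q (x' + s *\<^sub>R y) - s * q y)"
        using sublinear_add[OF q, of "x + t *\<^sub>R y" "x' + s *\<^sub>R y"] by (simp add: algebra_simps)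
    next
      fix r t :: real and x assume r: "0 \<le> r"
      have "r *\<^sub>R x + (r *\<^sub>R t) *\<^sub>R y = r *\<^sub>R (x + t *\<^sub>R y)"
        by (simp add: algebra_simps)
      then show "q (r *\<^sub>R x + (r *\<^sub>R t) *\<^sub>R y) - (r *\<^sub>R t) * q y = r * (q (x + t *\<^sub>R y) - t * q y)"
        using sublinear_scaleR[OF q r, of "x + t *\<^sub>R y"] by (simp add: algebra_simps)
    qed (auto simp: bdd[simplified])
    moreover have lower: "q' x \<le> q (x + t *\<^sub>R y) - t * q y" if "0 \<le> t" for t x
      unfolding q'_def using that by (intro cINF_lower bdd_belowI2[of _ "- q (- x)"] bdd) auto
    have "q' \<le> q" using lower[of 0] by (auto simp: le_fun_def)
    ultimately have "q' = q" by (intro min)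
    then show ?thesis
      using lower[of 1 x] sublinear_add[OF q, of x y] by simp
  qed
  have "q (r *\<^sub>R x) = r * q x" for r x
  proof (cases "0 \<le> r")
    case False
    have "q (r *\<^sub>R x) = - q ((- r) *\<^sub>R x)"
      using add[of "r *\<^sub>R x" "- r *\<^sub>R x"] sublinear_zero[OF q] by simp
    also have "\<dots> = r * q x" using sublinear_scaleR[OF q, of "- r" x] False by simp
    finally show ?thesis .
  qed (rule sublinear_scaleR[OF q])
  then show ?thesis using add by (intro linearI) auto
qed

lemma sublinear_dominates_linear:
  assumes p: "sublinear p"
  shows "\<exists>u. linear u \<and> u \<le> p"
proof -
  define S where "S = {q. sublinear q \<and> q \<le> p}"
  have "\<exists>q\<in>S. \<forall>q'\<in>S. q' \<le> q \<longrightarrow> q' = q"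
  proof (rule predicate_Zorn)
    \<comment> \<open>The order is reversed, so that Zorn's lemma yields a minimal sublinear
      functional below \<open>p\<close>.\<close>
    show "partial_order_on S (relation_of (\<lambda>q q'. q' \<le> q) S)"
      by (auto intro!: partial_order_on_relation_ofI)
    fix C assume "C \<in> Chains (relation_of (\<lambda>q q'. q' \<le> q) S)"
    then have C: "C \<subseteq> S" and chain: "\<And>q q'. q \<in> C \<Longrightarrow> q' \<in> C \<Longrightarrow> q \<le> q' \<or> q' \<le> q"
      by (auto simp: Chains_def relation_of_def)
    show "\<exists>u\<in>S. \<forall>q\<in>C. u \<le> q"
    proof (cases "C = {}")
      case True
      then show ?thesis using p by (auto simp: S_def)
    next
      case False
      define u where "u x = (INF q\<in>C. q x)" for x
      have sub: "sublinear q" "q \<le> p" if "q \<in> C" for q using C that by (auto simp: S_def)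
      have bdd: "- p (- x) \<le> q x" if "q \<in> C" for q x
        using sublinear_ge_uminus[OF sub(1)[OF that], of x] sub(2)[OF that, THEN le_funD, of "- x"]
        by linarith
      have lower: "u x \<le> q x" if "q \<in> C" for q x
        unfolding u_def by (intro cINF_lower bdd_belowI2[of _ "- p (- x)"] bdd that)
      have "sublinear u"
      proof (rule sublinearI)
        fix x y
        have "u (x + y) - u y \<le> q x" if q: "q \<in> C" for q
        proof -
          have "u (x + y) - q x \<le> q' y" if q': "q' \<in> C" for q'
          proof -
            \<comment> \<open>The smaller of \<open>q\<close> and \<open>q'\<close> serves both
              arguments: \<open>u (x + y) \<le> r x + r y \<le> q x + q' y\<close>.\<close>
            obtain r where "r \<in> C" "r \<le> q" "r \<le> q'" using chain[OF q q'] q q' by blast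
            then show ?thesis
              using lower[of r "x + y"] sublinear_add[OF sub(1), of r x y] le_funD[of r q x]
                le_funD[of r q' y] by linarith
          qed
          then have "u (x + y) - q x \<le> u y"
            unfolding u_def[of y] by (rule cINF_greatest[OF False])
          then show ?thesis by linarith
        qed
        then have "u (x + y) - u y \<le> (INF q\<in>C. q x)"
          by (rule cINF_greatest[OF False])
        then show "u (x + y) \<le> u x + u y" by (simp add: u_def)
      next
        from False obtain q where "q \<in> C" by auto
        then show "u 0 \<le> 0" using lower[of q 0] sublinear_zero[OF sub(1), of q] by simp
      next
        fix r :: real and x assume r: "0 < r"
        have "u (r *\<^sub>R x) / r \<le> q x" if "q \<in> C" for q
          using lower[OF that, of "r *\<^sub>R x"] sublinear_scaleR[OF sub(1)[OF that], of r x] r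
          by (simp add: field_simps)
        then have "u (r *\<^sub>R x) / r \<le> (INF q\<in>C. q x)" by (rule cINF_greatest[OF False])
        then show "u (r *\<^sub>R x) \<le> r * u x" using r by (simp add: u_def field_simps)
      qed
      moreover from False obtain q where "q \<in> C" by auto
      then have "u \<le> p" using lower[of q] sub(2)[of q] by (auto simp: le_fun_def intro: order_trans)
      ultimately show ?thesis using lower by (auto simp: S_def le_fun_def)
    qed
  qed
  then obtain q where "q \<in> S" "\<And>q'. q' \<in> S \<Longrightarrow> q' \<le> q \<Longrightarrow> q' = q" by blast
  then show ?thesis
    using minimal_sublinear_imp_linear[of q] by (auto simp: S_def intro: order_trans)
qed

text \<open>
  Hahn-Banach for \<open>(x, y) \<longmapsto> max (b x) (c y)\<close> on the product space, extending \<open>f\<close> from the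
  diagonal. With \<open>v = f - u\<close>, the required bound only involves \<open>u (x - y)\<close>, so it is enough to dominate a
  linear \<open>u\<close> by the infimum of \<open>max (b (h + g)) (c g) - f g\<close> over \<open>g\<close>.
\<close>

lemma linear_split_max:
  assumes b: "sublinear b" and c: "sublinear c" and f: "linear f"
    and le: "\<And>x. f x \<le> max (b x) (c x)"
  shows "\<exists>u v. linear u \<and> linear v \<and> (\<forall>x. f x = u x + v x) \<and> (\<forall>x y. u x + v y \<le> max (b x) (c y))"
proof -
  define q where "q = (\<lambda>h. INF g. max (b (h + g)) (c g) - f g)"
  \<comment> \<open>If \<open>f g \<le> b g\<close>, subadditivity of \<open>b\<close> bounds the
    difference below by \<open>- b (- h)\<close>; if \<open>f g \<le> c g\<close>, it is
    nonnegative. The absolute value covers both cases.\<close>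
  have bdd: "- \<bar>b (- h)\<bar> \<le> max (b (h + g)) (c g) - f g" for h g
    using le[of g] sublinear_add[OF b, of "- h" "h + g"] by simp
  have "sublinear q"
    unfolding q_def
  proof (rule sublinear_INF[where m = "\<lambda>h. - \<bar>b (- h)\<bar>"])
    fix x y k l
    show "max (b (x + y + (k + l))) (c (k + l)) - f (k + l)
        \<le> max (b (x + k)) (c k) - f k + (max (b (y + l)) (c l) - f l)"
      using sublinear_add[OF b, of "x + k" "y + l"] sublinear_add[OF c, of k l] linear_add[OF f, of k l]
      unfolding add.assoc add.left_commute[of y] by linarith
  next
    fix r :: real and x k assume r: "0 \<le> r"
    show "max (b (r *\<^sub>R x + r *\<^sub>R k)) (c (r *\<^sub>R k)) - f (r *\<^sub>R k) = r * (max (b (x + k)) (c k) - f k)"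
      using sublinear_scaleR[OF b r, of "x + k"] sublinear_scaleR[OF c r, of k] linear_scale[OF f, of r k] r
      by (simp add: scaleR_add_right right_diff_distrib max_mult_distrib_left)
  qed (auto simp: bdd)
  then obtain u where u: "linear u" "u \<le> q" using sublinear_dominates_linear by blast
  have "u x + (f y - u y) \<le> max (b x) (c y)" for x y
  proof -
    have "u (x - y) \<le> q (x - y)" using u(2) by (simp add: le_fun_def)
    also have "\<dots> \<le> max (b (x - y + y)) (c y) - f y"
      unfolding q_def by (intro cINF_lower bdd_belowI2[of _ "- \<bar>b (- (x - y))\<bar>"] bdd) auto
    finally show ?thesis by (simp add: linear_diff[OF u(1)])
  qed
  moreover have "linear (\<lambda>y. f y - u y)" using f u(1) by (rule linear_compose_sub)
  ultimately show ?thesis using u(1) by (intro exI[of _ u] exI[of _ "\<lambda>y. f y - u y"]) auto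
qed

section \<open>Peak functions\<close>

lemma apply_Y_simps [simp]:
  "apply_Y (F + G) z = apply_Y F z + apply_Y G z"
  "apply_Y (F - G) z = apply_Y F z - apply_Y G z"
  "apply_Y (r *\<^sub>R F) z = r *\<^sub>R apply_Y F z"
  "apply_Y (c *\<^sub>Y F) z = c * apply_Y F z"
  "apply_Y 0 z = 0"
  by (simp_all add: plus_Y.rep_eq minus_Y.rep_eq scaleR_Y.rep_eq scaleC_Y.rep_eq zero_Y.rep_eq)

lemma Y_eqI: "(\<And>z. apply_Y F z = apply_Y G z) \<Longrightarrow> F = G"
  by (simp add: apply_Y_inject[symmetric] fun_eq_iff)

lemma norm_Y_le: "(\<And>z. z \<in> \<triangle> \<Longrightarrow> norm (apply_Y F z) \<le> M) \<Longrightarrow> norm F \<le> M"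
  by transfer (auto intro!: cSUP_least)

lemma apply_Y_C0: "apply_Y F \<in> C0_disc"
  using apply_Y[of F] Y_set_subset_C0 by auto

lemma apply_Y_outside: "z \<notin> \<triangle> \<Longrightarrow> apply_Y F z = 0"
  by (rule Y_outside[OF apply_Y])

lemma continuous_on_apply_Y: "continuous_on \<triangle> (apply_Y F)"
  using apply_Y_C0[of F] by (simp add: C0_disc_def)

text \<open>Integrating \<open>g\<close> twice from \<open>0\<close> gives a preimage under
  \<open>Phi\<close>. Holomorphy beyond the closed disc makes it continuous up to the circle and
  bounds \<open>g\<close>, so the weight forces the limit \<open>0\<close> there.\<close>

lemma weighted_holomorphic_in_Y:
  assumes R: "1 < R" and g: "g holomorphic_on ball 0 R"
  shows "(\<lambda>z. if z \<in> \<triangle> then of_real (1 - (norm z)\<^sup>2) * g z else 0) \<in> Y_set"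
proof -
  have sub: "cball 0 1 \<subseteq> ball (0::complex) R" using R by auto
  obtain h where h: "\<And>z. z \<in> ball 0 R \<Longrightarrow> (h has_field_derivative g z) (at z)"
    using holomorphic_convex_primitive'[OF convex_ball open_ball g] by (auto simp: at_within_open_NO_MATCH)
  have hd: "((\<lambda>z. h z - h 0) has_field_derivative g z) (at z)" if "z \<in> ball 0 R" for z
    using h[OF that] by (auto intro!: derivative_eq_intros)
  then have "(\<lambda>z. h z - h 0) holomorphic_on ball 0 R"
    unfolding holomorphic_on_open[OF open_ball] by blast
  from holomorphic_convex_primitive'[OF convex_ball open_ball this]
  obtain k where k: "\<And>z. z \<in> ball 0 R \<Longrightarrow> (k has_field_derivative h z - h 0) (at z)"
    by (auto simp: at_within_open_NO_MATCH)
  define f where "f z = k z - k 0" for z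
  have fd: "(f has_field_derivative h z - h 0) (at z)" if "z \<in> ball 0 R" for z
    unfolding f_def using k[OF that] by (auto intro!: derivative_eq_intros)
  then have hol: "f holomorphic_on ball 0 R"
    unfolding holomorphic_on_open[OF open_ball] by blast
  have d1: "deriv f z = h z - h 0" if "z \<in> ball 0 R" for z
    using fd[OF that] by (rule DERIV_imp_deriv)
  have d2: "(deriv ^^ 2) f z = g z" if z: "z \<in> ball 0 R" for z
  proof -
    have "(deriv f has_field_derivative g z) (at z)"
      by (rule has_field_derivative_transform_within_open[OF hd[OF z] open_ball z]) (simp add: d1)
    then show ?thesis by (simp add: numeral_2_eq_2 DERIV_imp_deriv)
  qed
  have Phi: "Phi f = (\<lambda>z. if z \<in> \<triangle> then of_real (1 - (norm z)\<^sup>2) * g z else 0)"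
  proof (rule ext)
    fix z show "Phi f z = (if z \<in> \<triangle> then of_real (1 - (norm z)\<^sup>2) * g z else 0)"
      using d2[of z] R by (auto simp: Phi_def)
  qed
  have "compact (g ` cball 0 1)"
    using g sub by (intro compact_continuous_image compact_cball)
      (auto intro: holomorphic_on_imp_continuous_on holomorphic_on_subset)
  then obtain M where M: "\<And>z. z \<in> cball 0 1 \<Longrightarrow> norm (g z) \<le> M"
    using compact_imp_bounded bounded_iff by (metis imageI)
  have M0: "0 \<le> M" using M[of 0] norm_ge_zero[of "g 0"] by (auto simp del: norm_ge_zero)
  have bound: "norm (Phi f z) \<le> (1 - (norm z)\<^sup>2) * M" if "z \<in> \<triangle>" for z
    unfolding norm_Phi[OF that] using that M[of z] d2[of z] R norm_sq_disc_le[OF that]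
    by (intro mult_left_mono) auto
  have "((\<lambda>x::real. (1 - x\<^sup>2) * M) \<longlongrightarrow> (1 - 1\<^sup>2) * M) (at_left 1)"
    by (intro tendsto_intros)
  then have "((\<lambda>z::complex. (1 - (norm z)\<^sup>2) * M) \<longlongrightarrow> 0) to_circle"
    by (intro filterlim_filtercomapI) simp
  then have lim: "(Phi f \<longlongrightarrow> 0) to_circle"
    by (rule Lim_null_comparison[rotated]) (auto intro: eventually_mono[OF eventually_to_circle] bound)
  have "bdd_above ((\<lambda>z. norm (Phi f z)) ` \<triangle>)"
  proof (rule bdd_aboveI2)
    fix z assume z: "z \<in> \<triangle>"
    have "(1 - (norm z)\<^sup>2) * M \<le> 1 * M" using M0 by (intro mult_right_mono) auto
    with bound[OF z] show "norm (Phi f z) \<le> M" by simp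
  qed
  moreover have "continuous_on (closure \<triangle>) f"
    using hol sub by (auto intro: holomorphic_on_imp_continuous_on continuous_on_subset)
  moreover have "f holomorphic_on \<triangle>"
    using hol sub by (rule holomorphic_on_subset[OF _ order_trans[OF ball_subset_cball]])
  moreover have "f 0 = 0" "deriv f 0 = 0"
    using R d1[of 0] by (auto simp: f_def)
  ultimately have "f \<in> little_zygmund01"
    using lim by (auto simp: little_zygmund01_iff)
  then show ?thesis unfolding Y_set_def Phi[symmetric] by (rule imageI)
qed

text \<open>Dividing by the first square shows that the modulus of the peak function is one minus
  the squared pseudohyperbolic distance from \<open>z\<close> to \<open>a\<close>.\<close>

lemma peak_identity:
  fixes a z :: complex
  shows "(norm (1 - cnj a * z))\<^sup>2 - (norm (z - a))\<^sup>2 = (1 - (norm z)\<^sup>2) * (1 - (norm a)\<^sup>2)"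
  unfolding cmod_power2 by (simp add: power2_eq_square algebra_simps)

lemma peak_in_Y:
  assumes a: "a \<in> \<triangle>"
  obtains P where "apply_Y P a = 1" "norm P \<le> 1"
    and "\<And>z. z \<in> \<triangle> \<Longrightarrow> norm (apply_Y P z) \<le> 1 - (norm (z - a))\<^sup>2 / 4"
proof -
  define g where "g z = of_real (1 - (norm a)\<^sup>2) / (1 - cnj a * z)\<^sup>2" for z
  \<comment> \<open>This radius satisfies both \<open>1 < R\<close> and
    \<open>norm a * R < 1\<close>, so the pole of \<open>g\<close>, if any, lies outside
    \<open>ball 0 R\<close>.\<close>
  define R where "R = 2 / (1 + norm a)"
  have R: "1 < R" using a by (simp add: R_def field_simps add_pos_nonneg)
  have aR: "norm a * R < 1" using a by (simp add: R_def field_simps add_pos_nonneg)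
  have nz: "1 - cnj a * z \<noteq> 0" if "z \<in> ball 0 R" for z
  proof
    assume "1 - cnj a * z = 0"
    then have "norm (cnj a * z) = 1" by simp
    then have "1 = norm a * norm z" by (simp add: norm_mult)
    also have "\<dots> \<le> norm a * R" using that by (intro mult_left_mono) auto
    finally show False using aR by simp
  qed
  have "g holomorphic_on ball 0 R"
    unfolding g_def by (intro holomorphic_intros) (use nz in auto)
  from weighted_holomorphic_in_Y[OF R this] obtain P where
    P: "apply_Y P = (\<lambda>z. if z \<in> \<triangle> then of_real (1 - (norm z)\<^sup>2) * g z else 0)"
    using Abs_Y_inverse by blast
  have nz1: "1 - cnj a * z \<noteq> 0" if "z \<in> \<triangle>" for z using nz[of z] R that by simp
  have bound: "norm (apply_Y P z) \<le> 1 - (norm (z - a))\<^sup>2 / 4" if z: "z \<in> \<triangle>" for z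
  proof -
    let ?n = "norm (1 - cnj a * z)"
    have n: "0 < ?n" using nz1[OF z] by simp
    have "?n \<le> 1 + norm a * norm z"
      using norm_triangle_ineq4[of 1 "cnj a * z"] by (simp add: norm_mult)
    also have "\<dots> \<le> 1 + 1 * 1" using a z by (intro add_left_mono mult_mono) auto
    finally have n2: "?n\<^sup>2 \<le> 2\<^sup>2" by (intro power_mono) auto
    have "norm (apply_Y P z) = (1 - (norm z)\<^sup>2) * (1 - (norm a)\<^sup>2) / ?n\<^sup>2"
      using z a norm_sq_disc_le[OF z] norm_sq_disc_le[OF a]
      by (simp add: P g_def norm_mult norm_divide norm_power del: of_real_diff)
    also have "\<dots> = 1 - (norm (z - a))\<^sup>2 / ?n\<^sup>2"
      using n by (simp add: peak_identity[symmetric] diff_divide_distrib)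
    also have "\<dots> \<le> 1 - (norm (z - a))\<^sup>2 / 4"
      using n n2 by (intro diff_left_mono divide_left_mono) auto
    finally show ?thesis .
  qed
  show ?thesis
  proof (rule that)
    have "1 - cnj a * a = of_real (1 - (norm a)\<^sup>2)"
      by (simp add: complex_norm_square[simplified] mult.commute)
    then show "apply_Y P a = 1" using a nz1[OF a] by (simp add: P g_def power2_eq_square)
  next
    have "norm (apply_Y P z) \<le> 1" if "z \<in> \<triangle>" for z
      using bound[OF that] zero_le_power2[of "norm (z - a)"] by linarith
    then show "norm P \<le> 1" by (rule norm_Y_le)
  qed (rule bound)
qed

section \<open>Evaluations as extreme points of the dual ball\<close>

lemma dual_Y_apply_scaleC: "\<phi> \<in> dual_Y \<Longrightarrow> blinfun_apply \<phi> (c *\<^sub>Y F) = c * blinfun_apply \<phi> F"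
  by (simp add: dual_Y_def)

lemma delta_in_dual_ball: "\<delta> z \<in> dual_ball_Y"
  by (auto simp: dual_ball_Y_def dual_Y_def norm_Y_ge intro!: norm_blinfun_bound)

lemma norm_dual_ball_apply: "\<phi> \<in> dual_ball_Y \<Longrightarrow> norm (blinfun_apply \<phi> F) \<le> norm F"
  using norm_blinfun[of \<phi> F] mult_right_mono[of "norm \<phi>" 1 "norm F"]
  by (simp add: dual_ball_Y_def)

lemma scaleC_delta_in_dual_ball: "norm c \<le> 1 \<Longrightarrow> c *\<^sub>D \<delta> z \<in> dual_ball_Y"
  by (auto simp: dual_ball_Y_def dual_Y_def norm_mult
      intro!: norm_blinfun_bound order_trans[OF mult_mono[OF _ norm_Y_ge]])

text \<open>The difference of \<open>F\<close> and \<open>F a\<close> times \<open>P\<close>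
  vanishes at \<open>a\<close>, hence is killed by \<open>\<phi>\<close>.\<close>

lemma dual_eq_scaleC_deltaI:
  assumes "\<phi> \<in> dual_Y" and ker: "\<And>G. apply_Y G a = 0 \<Longrightarrow> blinfun_apply \<phi> G = 0"
    and P: "apply_Y P a = 1"
  shows "\<phi> = blinfun_apply \<phi> P *\<^sub>D \<delta> a"
proof (rule blinfun_eqI)
  fix F
  have "blinfun_apply \<phi> (F - apply_Y F a *\<^sub>Y P) = 0"
    by (rule ker) (simp add: P)
  then show "blinfun_apply \<phi> F = blinfun_apply (blinfun_apply \<phi> P *\<^sub>D \<delta> a) F"
    by (simp add: blinfun.diff_right dual_Y_apply_scaleC[OF assms(1)] mult.commute)
qed

text \<open>A small multiple of \<open>G\<close> is added to \<open>P\<close>. Near \<open>a\<close>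
  the modulus of \<open>G\<close> is below half of \<open>norm (blinfun_apply \<phi> G)\<close>;
  farther away the gap below \<open>1\<close> left by \<open>P\<close> absorbs it. So the norm grows
  by at most \<open>e * d\<close>, while the value under \<open>\<phi>\<close> gains
  \<open>2 * e * d\<close>.\<close>

lemma dual_peak_vanishes:
  assumes \<phi>: "\<phi> \<in> dual_ball_Y" and a: "a \<in> \<triangle>"
    and P: "\<And>z. z \<in> \<triangle> \<Longrightarrow> norm (apply_Y P z) \<le> 1 - (norm (z - a))\<^sup>2 / 4"
    and attain: "norm (blinfun_apply \<phi> P) = 1" and G: "apply_Y G a = 0"
  shows "blinfun_apply \<phi> G = 0"
proof (rule ccontr)
  assume nz: "blinfun_apply \<phi> G \<noteq> 0"
  define d where "d = norm (blinfun_apply \<phi> G) / 2"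
  have d: "0 < d" using nz by (simp add: d_def)
  have "continuous (at a) (apply_Y G)"
    using continuous_on_apply_Y a by (simp add: continuous_on_eq_continuous_at)
  then obtain r where r: "0 < r" "\<And>z. dist z a < r \<Longrightarrow> norm (apply_Y G z) < d"
    using d G unfolding continuous_at_eps_delta by (metis dist_0_norm dist_commute)
  \<comment> \<open>Chosen so that \<open>e * (norm G + 1) = r\<^sup>2 / 4\<close>, the gap of
    \<open>P\<close> outside the \<open>r\<close>-neighbourhood of \<open>a\<close>; the
    \<open>+ 1\<close> keeps the denominator positive.\<close>
  define e where "e = r\<^sup>2 / (4 * (norm G + 1))"
  have e: "0 < e" using r by (simp add: e_def add_nonneg_pos)
  \<comment> \<open>The rotation aligns \<open>\<phi> G\<close> with \<open>\<phi> P\<close>, so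
    that their moduli add up.\<close>
  define c where "c = of_real (norm (blinfun_apply \<phi> G)) * blinfun_apply \<phi> P / blinfun_apply \<phi> G"
  have c: "norm c = 1" "c * blinfun_apply \<phi> G = of_real (norm (blinfun_apply \<phi> G)) * blinfun_apply \<phi> P"
    using nz attain by (simp_all add: c_def norm_mult norm_divide)
  define H where "H = P + (of_real e * c) *\<^sub>Y G"
  have "norm H \<le> 1 + e * d"
  proof (rule norm_Y_le)
    fix z assume z: "z \<in> \<triangle>"
    have H: "norm (apply_Y H z) \<le> 1 - (norm (z - a))\<^sup>2 / 4 + e * norm (apply_Y G z)"
      unfolding H_def using P[OF z] e c(1)
      by (auto simp: norm_mult intro!: order_trans[OF norm_triangle_ineq])
    show "norm (apply_Y H z) \<le> 1 + e * d"
    proof (cases "dist z a < r")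
      case True
      have "e * norm (apply_Y G z) \<le> e * d" using r(2)[OF True] e by (intro mult_left_mono) auto
      moreover have "0 \<le> (norm (z - a))\<^sup>2" by simp
      ultimately show ?thesis using H by linarith
    next
      case False
      then have "r\<^sup>2 \<le> (norm (z - a))\<^sup>2" using r(1) by (intro power_mono) (auto simp: dist_norm)
      moreover have "e * norm (apply_Y G z) \<le> e * (norm G + 1)"
        using norm_Y_ge[of G z] e by (intro mult_left_mono) auto
      moreover have "e * (norm G + 1) = r\<^sup>2 / 4"
        using add_nonneg_pos[OF norm_ge_zero zero_less_one, of G] by (simp add: e_def field_simps)
      moreover have "0 < e * d" using e d by simp
      ultimately show ?thesis using H by linarith
    qed
  qed
  moreover have "blinfun_apply \<phi> H = blinfun_apply \<phi> P * of_real (1 + e * (2 * d))"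
    using \<phi> c(2) by (simp add: H_def blinfun.add_right dual_ball_Y_def dual_Y_apply_scaleC d_def algebra_simps)
  then have "norm (blinfun_apply \<phi> H) = 1 + e * (2 * d)"
    using attain e d by (simp add: norm_mult del: of_real_add of_real_mult)
  moreover note norm_dual_ball_apply[OF \<phi>, of H]
  ultimately show False using mult_pos_pos[OF e d] by simp
qed

text \<open>At the peak function both endpoints of the segment take values in the closed unit disc,
  with the unimodular \<open>c\<close> as a proper convex combination. Strict convexity makes both
  values \<open>c\<close>, and then the peak determines both functionals.\<close>

lemma scaleC_delta_extreme:
  assumes a: "a \<in> \<triangle>" and c: "norm c = 1"
  shows "(c *\<^sub>D \<delta> a) extreme_point_of dual_ball_Y"
  unfolding extreme_point_of_def
proof (intro conjI ballI notI)
  show "c *\<^sub>D \<delta> a \<in> dual_ball_Y" using c by (simp add: scaleC_delta_in_dual_ball)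
next
  fix \<psi> \<xi> assume ball: "\<psi> \<in> dual_ball_Y" "\<xi> \<in> dual_ball_Y"
    and seg: "c *\<^sub>D \<delta> a \<in> open_segment \<psi> \<xi>"
  obtain P where Pa: "apply_Y P a = 1" and normP: "norm P \<le> 1"
    and P: "\<And>z. z \<in> \<triangle> \<Longrightarrow> norm (apply_Y P z) \<le> 1 - (norm (z - a))\<^sup>2 / 4"
    using peak_in_Y[OF a] by blast
  have le: "norm (blinfun_apply \<psi> P) \<le> 1" "norm (blinfun_apply \<xi> P) \<le> 1"
    using norm_dual_ball_apply[OF ball(1), of P] norm_dual_ball_apply[OF ball(2), of P] normP by auto
  obtain t where "\<psi> \<noteq> \<xi>" and t: "0 < t" "t < 1" "c *\<^sub>D \<delta> a = (1 - t) *\<^sub>R \<psi> + t *\<^sub>R \<xi>"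
    using seg by (auto simp: in_segment)
  have ct: "c = (1 - t) *\<^sub>R blinfun_apply \<psi> P + t *\<^sub>R blinfun_apply \<xi> P"
    using arg_cong[OF t(3), of "\<lambda>\<phi>. blinfun_apply \<phi> P"] Pa
    by (simp add: blinfun.add_left blinfun.scaleR_left)
  have eq: "blinfun_apply \<psi> P = blinfun_apply \<xi> P"
  proof (rule ccontr)
    assume "blinfun_apply \<psi> P \<noteq> blinfun_apply \<xi> P"
    then have "c \<in> open_segment (blinfun_apply \<psi> P) (blinfun_apply \<xi> P)"
      using ct t by (auto simp: in_segment)
    from dist_decreases_open_segment[OF this, of 0] show False using c le by auto
  qed
  with ct have cP: "blinfun_apply \<psi> P = c" "blinfun_apply \<xi> P = c"
    by (simp_all add: scaleR_left.add[symmetric] scaleR_add_left[symmetric])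
  have "\<psi> = c *\<^sub>D \<delta> a"
    using dual_eq_scaleC_deltaI[OF _ dual_peak_vanishes[OF ball(1) a P] Pa] ball(1) cP c
    by (simp add: dual_ball_Y_def)
  moreover have "\<xi> = c *\<^sub>D \<delta> a"
    using dual_eq_scaleC_deltaI[OF _ dual_peak_vanishes[OF ball(2) a P] Pa] ball(2) cP c
    by (simp add: dual_ball_Y_def)
  ultimately show False using \<open>\<psi> \<noteq> \<xi>\<close> by simp
qed

section \<open>Carriers of extreme functionals\<close>

text \<open>
  The point \<open>1\<close>, at which every member of \<open>Y\<close> takes the junk value \<open>0\<close>, makes the supremum over the empty set
  equal to \<open>0\<close>.
\<close>

definition sup_on :: "complex set \<Rightarrow> Y \<Rightarrow> real" where
  "sup_on A F = (SUP z\<in>insert 1 A. norm (apply_Y F z))"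

lemma sup_on_upper: "z \<in> insert 1 A \<Longrightarrow> norm (apply_Y F z) \<le> sup_on A F"
  unfolding sup_on_def by (intro cSUP_upper bdd_aboveI2[of _ _ "norm F"] norm_Y_ge)

lemma sup_on_nonneg: "0 \<le> sup_on A F"
  using sup_on_upper[of 1 A F] by (simp add: apply_Y_outside)

lemma sup_on_least:
  "0 \<le> M \<Longrightarrow> (\<And>z. z \<in> A \<Longrightarrow> norm (apply_Y F z) \<le> M) \<Longrightarrow> sup_on A F \<le> M"
  unfolding sup_on_def by (rule cSUP_least) (auto simp: apply_Y_outside)

lemma sup_on_le_norm: "sup_on A F \<le> norm F"
  by (rule sup_on_least) (auto simp: norm_Y_ge)

lemma norm_le_sup_on_disc: "norm F \<le> sup_on \<triangle> F"
  by (rule norm_Y_le) (simp add: sup_on_upper)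

lemma sup_on_Un: "sup_on (A \<union> B) F \<le> max (sup_on A F) (sup_on B F)"
  by (rule sup_on_least) (auto simp: le_max_iff_disj sup_on_nonneg sup_on_upper)

lemma sup_on_mono: "A \<subseteq> B \<Longrightarrow> sup_on A F \<le> sup_on B F"
  by (rule sup_on_least) (auto simp: sup_on_nonneg sup_on_upper)

lemma sup_on_scaleC: "norm c = 1 \<Longrightarrow> sup_on A (c *\<^sub>Y F) = sup_on A F"
  by (simp add: sup_on_def norm_mult)

lemma sublinear_sup_on: "sublinear (sup_on A)"
proof (rule sublinearI)
  fix F G show "sup_on A (F + G) \<le> sup_on A F + sup_on A G"
    by (rule sup_on_least)
      (auto intro!: add_nonneg_nonneg sup_on_nonneg order_trans[OF norm_triangle_ineq] add_mono sup_on_upper)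
next
  show "sup_on A 0 \<le> 0" by (rule sup_on_least) auto
next
  fix r :: real and F assume "0 < r"
  then show "sup_on A (r *\<^sub>R F) \<le> r * sup_on A F"
    by (intro sup_on_least) (auto simp: sup_on_nonneg intro!: mult_left_mono sup_on_upper)
qed

section \<open>Splitting a functional through its real part\<close>

lemma exists_unimodular:
  obtains c :: complex where "norm c = 1" "c * z = of_real (norm z)"
proof (cases "z = 0")
  case True
  then show ?thesis using that[of 1] by simp
next
  case False
  then show ?thesis
    using that[of "of_real (norm z) / z"] by (simp add: norm_divide)
qed

text \<open>The imaginary part is recovered from the real part at
  \<open>\<i> *\<^sub>Y F\<close>.\<close>

lemma dual_Y_eqI:
  assumes "\<phi> \<in> dual_Y" "\<psi> \<in> dual_Y" "\<And>F. Re (blinfun_apply \<phi> F) = Re (blinfun_apply \<psi> F)"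
  shows "\<phi> = \<psi>"
proof (rule blinfun_eqI)
  fix F
  show "blinfun_apply \<phi> F = blinfun_apply \<psi> F"
    using assms(3)[of F] assms(3)[of "\<i> *\<^sub>Y F"]
    by (simp add: complex_eq_iff dual_Y_apply_scaleC assms(1,2))
qed

text \<open>The usual complexification of \<open>u\<close>. Rotating \<open>F\<close> so that the
  value becomes real and nonnegative turns the one-sided bound on \<open>u\<close> into a bound on
  the modulus.\<close>

lemma dual_Y_of_real_part:
  assumes u: "linear u" and bound: "\<And>F. u F \<le> norm F"
  obtains \<phi> where "\<phi> \<in> dual_Y" "\<And>F. Re (blinfun_apply \<phi> F) = u F"
proof -
  define f where "f F = Complex (u F) (- u (\<i> *\<^sub>Y F))" for F
  have dist: "c *\<^sub>Y (F + G) = c *\<^sub>Y F + c *\<^sub>Y G" for c F G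
    by (rule Y_eqI) (simp add: algebra_simps)
  have comm: "\<i> *\<^sub>Y (r *\<^sub>R F) = r *\<^sub>R (\<i> *\<^sub>Y F)" for r F
    by (rule Y_eqI) simp
  have lin: "linear f"
    by (rule linearI)
      (simp_all add: f_def complex_eq_iff dist comm linear_add[OF u] linear_scale[OF u])
  have "\<i> *\<^sub>Y \<i> *\<^sub>Y F = - F" for F
    by (rule Y_eqI) (simp add: uminus_Y.rep_eq)
  then have i: "f (\<i> *\<^sub>Y F) = \<i> * f F" for F
    by (simp add: f_def complex_eq_iff linear_neg[OF u])
  have scale: "f (c *\<^sub>Y F) = c * f F" for c F
  proof -
    have "c *\<^sub>Y F = Re c *\<^sub>R F + Im c *\<^sub>R (\<i> *\<^sub>Y F)"
      by (rule Y_eqI) (simp add: complex_eq_iff)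
    then have "f (c *\<^sub>Y F) = Re c *\<^sub>R f F + Im c *\<^sub>R (\<i> * f F)"
      by (simp only: linear_add[OF lin] linear_scale[OF lin] i)
    then show ?thesis by (simp add: complex_eq_iff)
  qed
  have "norm (f F) \<le> norm F * 1" for F
  proof -
    obtain c where c: "norm c = 1" "c * f F = of_real (norm (f F))" by (rule exists_unimodular)
    have "norm (f F) = Re (f (c *\<^sub>Y F))" by (simp add: scale c)
    also have "\<dots> \<le> norm (c *\<^sub>Y F)" using bound by (simp add: f_def)
    also have "\<dots> \<le> norm F" by (rule norm_Y_le) (simp add: norm_mult c norm_Y_ge)
    finally show ?thesis by simp
  qed
  then have bl: "bounded_linear f"
    by (intro bounded_linear_intro[where K = 1]) (simp_all add: linear_add[OF lin] linear_scale[OF lin])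
  show ?thesis
    by (rule that[of "Blinfun f"])
      (simp_all add: dual_Y_def bounded_linear_Blinfun_apply[OF bl] scale, simp add: f_def)
qed

lemma dual_Y_add: "\<phi> \<in> dual_Y \<Longrightarrow> \<psi> \<in> dual_Y \<Longrightarrow> \<phi> + \<psi> \<in> dual_Y"
  by (simp add: dual_Y_def blinfun.add_left algebra_simps)

lemma dual_Y_scaleR: "\<phi> \<in> dual_Y \<Longrightarrow> r *\<^sub>R \<phi> \<in> dual_Y"
  by (simp add: dual_Y_def blinfun.scaleR_left)

text \<open>The real part is split by \<open>linear_split_max\<close> and both summands are
  complexified. The suprema are invariant under unimodular factors, so \<open>F\<close> and
  \<open>G\<close> may be rotated independently to pass from real parts to moduli.\<close>

lemma dual_Y_split:
  assumes \<phi>: "\<phi> \<in> dual_Y" and le: "\<And>F. norm (blinfun_apply \<phi> F) \<le> sup_on (A \<union> B) F"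
  obtains \<phi>1 \<phi>2 where "\<phi>1 \<in> dual_Y" "\<phi>2 \<in> dual_Y" "\<phi> = \<phi>1 + \<phi>2"
    and "\<And>F G. norm (blinfun_apply \<phi>1 F) + norm (blinfun_apply \<phi>2 G) \<le> max (sup_on A F) (sup_on B G)"
proof -
  have "linear (\<lambda>F. Re (blinfun_apply \<phi> F))"
    by (rule linearI) (simp_all add: blinfun.add_right blinfun.scaleR_right)
  moreover have "Re (blinfun_apply \<phi> F) \<le> max (sup_on A F) (sup_on B F)" for F
    using complex_Re_le_cmod[of "blinfun_apply \<phi> F"] le[of F] sup_on_Un[of A B F] by linarith
  ultimately obtain u v where uv: "linear u" "linear v" "\<And>F. Re (blinfun_apply \<phi> F) = u F + v F"
    and max: "\<And>F G. u F + v G \<le> max (sup_on A F) (sup_on B G)"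
    using linear_split_max[OF sublinear_sup_on sublinear_sup_on] by meson
  have "u F \<le> norm F" for F
    using max[of F 0] sup_on_le_norm[of A F] sublinear_zero[OF sublinear_sup_on, of B]
      sup_on_nonneg[of A F] linear_0[OF uv(2)] by linarith
  then obtain \<phi>1 where \<phi>1: "\<phi>1 \<in> dual_Y" "\<And>F. Re (blinfun_apply \<phi>1 F) = u F"
    using dual_Y_of_real_part[OF uv(1)] by blast
  have "v F \<le> norm F" for F
    using max[of 0 F] sup_on_le_norm[of B F] sublinear_zero[OF sublinear_sup_on, of A]
      sup_on_nonneg[of B F] linear_0[OF uv(1)] by linarith
  then obtain \<phi>2 where \<phi>2: "\<phi>2 \<in> dual_Y" "\<And>F. Re (blinfun_apply \<phi>2 F) = v F"
    using dual_Y_of_real_part[OF uv(2)] by blast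
  show ?thesis
  proof (rule that[OF \<phi>1(1) \<phi>2(1)])
    show "\<phi> = \<phi>1 + \<phi>2"
      by (rule dual_Y_eqI) (simp_all add: \<phi> \<phi>1 \<phi>2 dual_Y_add blinfun.add_left uv(3))
  next
    fix F G
    obtain c d where cd: "norm c = 1" "c * blinfun_apply \<phi>1 F = of_real (norm (blinfun_apply \<phi>1 F))"
        "norm d = 1" "d * blinfun_apply \<phi>2 G = of_real (norm (blinfun_apply \<phi>2 G))"
      by (metis exists_unimodular)
    have "norm (blinfun_apply \<phi>1 F) = Re (blinfun_apply \<phi>1 (c *\<^sub>Y F))"
      "norm (blinfun_apply \<phi>2 G) = Re (blinfun_apply \<phi>2 (d *\<^sub>Y G))"
      by (simp_all add: dual_Y_apply_scaleC \<phi>1(1) \<phi>2(1) cd)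
    then show "norm (blinfun_apply \<phi>1 F) + norm (blinfun_apply \<phi>2 G) \<le> max (sup_on A F) (sup_on B G)"
      using max[of "c *\<^sub>Y F" "d *\<^sub>Y G"] by (simp add: \<phi>1(2) \<phi>2(2) sup_on_scaleC cd)
  qed
qed

section \<open>Localising extreme functionals\<close>

lemma norm_extreme_eq_1:
  assumes "\<phi> extreme_point_of dual_ball_Y"
  shows "norm \<phi> = 1"
proof (rule ccontr)
  assume "norm \<phi> \<noteq> 1"
  moreover have \<phi>: "\<phi> \<in> dual_Y" "norm \<phi> \<le> 1"
    using assms by (auto simp: extreme_point_of_def dual_ball_Y_def)
  ultimately have e: "0 < 1 - norm \<phi>" by simp
  \<comment> \<open>A nonzero perturbation of norm at most \<open>1 - norm \<phi>\<close>: both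
    \<open>\<phi> + \<psi>\<close> and \<open>\<phi> - \<psi>\<close> stay in the ball, with
    \<open>\<phi>\<close> as their midpoint.\<close>
  define \<psi> where "\<psi> = (1 - norm \<phi>) *\<^sub>R \<delta> 0"
  have \<delta>: "\<delta> 0 \<in> dual_Y" "norm (\<delta> 0) \<le> 1"
    using delta_in_dual_ball[of 0] by (auto simp: dual_ball_Y_def)
  obtain P where "apply_Y P 0 = 1" using peak_in_Y[of 0] by auto
  then have "blinfun_apply \<psi> P \<noteq> 0" using e by (simp add: \<psi>_def blinfun.scaleR_left)
  then have nz: "\<psi> \<noteq> 0" by auto
  have "norm \<psi> \<le> 1 - norm \<phi>"
    using \<delta>(2) e mult_left_mono[of "norm (\<delta> 0)" 1 "1 - norm \<phi>"] by (simp add: \<psi>_def)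
  then have "norm (\<phi> + \<psi>) \<le> 1" "norm (\<phi> - \<psi>) \<le> 1"
    using norm_triangle_ineq[of \<phi> \<psi>] norm_triangle_ineq4[of \<phi> \<psi>] by auto
  moreover have "\<phi> + \<psi> \<in> dual_Y" "\<phi> - \<psi> \<in> dual_Y"
    using dual_Y_add[OF \<phi>(1) dual_Y_scaleR[OF \<delta>(1)], of "1 - norm \<phi>"]
      dual_Y_add[OF \<phi>(1) dual_Y_scaleR[OF \<delta>(1)], of "- (1 - norm \<phi>)"]
    by (simp_all only: \<psi>_def scaleR_minus_left diff_conv_add_uminus[symmetric])
  ultimately have "\<phi> + \<psi> \<in> dual_ball_Y" "\<phi> - \<psi> \<in> dual_ball_Y"
    by (auto simp: dual_ball_Y_def)
  moreover have "\<phi> \<in> open_segment (\<phi> + \<psi>) (\<phi> - \<psi>)"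
  proof -
    have "midpoint (\<phi> + \<psi>) (\<phi> - \<psi>) = \<phi>"
      by (simp add: midpoint_def scaleR_2[symmetric])
    moreover have "\<phi> + \<psi> \<noteq> \<phi> - \<psi>"
    proof
      assume "\<phi> + \<psi> = \<phi> - \<psi>"
      then have "2 *\<^sub>R \<psi> = 0" by (simp add: scaleR_2 algebra_simps)
      with nz show False by simp
    qed
    ultimately show ?thesis by (metis midpoint_in_open_segment)
  qed
  ultimately show False using assms by (auto simp: extreme_point_of_def)
qed

text \<open>Each nonzero \<open>G\<close> is rescaled to norm \<open>B\<close>, which amounts to
  taking the supremum over the ball of radius \<open>B\<close>. For \<open>B = 0\<close> the
  instance \<open>G = 0\<close> suffices.\<close>

lemma norm_blinfun_scaled_bound:
  fixes \<psi> :: "'a::real_normed_vector \<Rightarrow>\<^sub>L 'b::real_normed_vector"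
  assumes B: "0 \<le> B" and le: "\<And>G. norm G \<le> B \<Longrightarrow> X + norm (blinfun_apply \<psi> G) \<le> B"
  shows "X + B * norm \<psi> \<le> B"
proof (cases "B = 0")
  case True
  then show ?thesis using le[of 0] by simp
next
  case False
  with B have B: "0 < B" by simp
  have "norm \<psi> \<le> (B - X) / B"
  proof (rule norm_blinfun_bound)
    show "0 \<le> (B - X) / B" using le[of 0] B by simp
  next
    fix G
    show "norm (blinfun_apply \<psi> G) \<le> (B - X) / B * norm G"
    proof (cases "G = 0")
      case False
      then have "X + B / norm G * norm (blinfun_apply \<psi> G) \<le> B"
        using le[of "(B / norm G) *\<^sub>R G"] B by (simp add: blinfun.scaleR_right)
      then show ?thesis using False B by (simp add: field_simps)
    qed simp
  qed
  then show ?thesis using B by (simp add: field_simps)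
qed

text \<open>The bound with the maximum forces the norms of the two parts to add up to
  \<open>1\<close>, so \<open>\<phi>\<close> is a convex combination of the normalised parts.
  Extremality makes these equal to \<open>\<phi>\<close>, and \<open>bound\<close> then shows that
  \<open>A\<close> carries it.\<close>

lemma extreme_sup_on_Un:
  assumes ext: "\<phi> extreme_point_of dual_ball_Y"
    and le: "\<And>F. norm (blinfun_apply \<phi> F) \<le> sup_on (A \<union> B) F"
  shows "(\<forall>F. norm (blinfun_apply \<phi> F) \<le> sup_on A F) \<or> (\<forall>F. norm (blinfun_apply \<phi> F) \<le> sup_on B F)"
proof -
  have \<phi>: "\<phi> \<in> dual_Y" using ext by (auto simp: extreme_point_of_def dual_ball_Y_def)
  obtain \<phi>1 \<phi>2 where split: "\<phi>1 \<in> dual_Y" "\<phi>2 \<in> dual_Y" "\<phi> = \<phi>1 + \<phi>2"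
    and max: "\<And>F G. norm (blinfun_apply \<phi>1 F) + norm (blinfun_apply \<phi>2 G) \<le> max (sup_on A F) (sup_on B G)"
    using dual_Y_split[OF \<phi> le] by blast
  \<comment> \<open>When \<open>G\<close> ranges over the ball of radius \<open>sup_on A F\<close>,
    the maximum collapses to \<open>sup_on A F\<close>.\<close>
  have bound: "norm (blinfun_apply \<phi>1 F) \<le> (1 - norm \<phi>2) * sup_on A F" for F
  proof -
    have "norm (blinfun_apply \<phi>1 F) + sup_on A F * norm \<phi>2 \<le> sup_on A F"
    proof (rule norm_blinfun_scaled_bound[OF sup_on_nonneg])
      fix G :: Y assume "norm G \<le> sup_on A F"
      then show "norm (blinfun_apply \<phi>1 F) + norm (blinfun_apply \<phi>2 G) \<le> sup_on A F"
        using max[of F G] sup_on_le_norm[of B G] by linarith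
    qed
    then show ?thesis by (simp add: algebra_simps)
  qed
  consider "\<phi>1 = 0" | "\<phi>2 = 0" | "\<phi>1 \<noteq> 0" "\<phi>2 \<noteq> 0" by blast
  then show ?thesis
  proof cases
    case 1
    then have "norm (blinfun_apply \<phi> G) \<le> sup_on B G" for G
      using max[of 0 G] split(3) sup_on_nonneg[of B G] sublinear_zero[OF sublinear_sup_on, of A]
      by simp
    then show ?thesis by blast
  next
    case 2
    then have "norm (blinfun_apply \<phi> F) \<le> sup_on A F" for F
      using bound[of F] split(3) by simp
    then show ?thesis by blast
  next
    case 3
    define n m where "n = norm \<phi>1" and "m = norm \<phi>2"
    have n: "0 < n" and m: "0 < m" using 3 by (auto simp: n_def m_def)
    \<comment> \<open>This makes the factor \<open>1 - norm \<phi>2\<close> nonnegative, as the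
      monotonicity step for \<open>n\<close> requires.\<close>
    have "0 + 1 * m \<le> 1"
      unfolding m_def
    proof (rule norm_blinfun_scaled_bound)
      fix G :: Y assume "norm G \<le> 1"
      then show "0 + norm (blinfun_apply \<phi>2 G) \<le> 1"
        using max[of 0 G] sup_on_le_norm[of B G] sublinear_zero[OF sublinear_sup_on, of A] by simp
    qed simp
    then have "n \<le> 1 - m"
      unfolding n_def m_def
      by (intro norm_blinfun_bound order_trans[OF bound] mult_left_mono sup_on_le_norm) auto
    moreover have "1 \<le> n + m"
      using norm_triangle_ineq[of \<phi>1 \<phi>2] norm_extreme_eq_1[OF ext] split(3) by (simp add: n_def m_def)
    ultimately have nm: "n = 1 - m" by simp
    have ball: "(1 / n) *\<^sub>R \<phi>1 \<in> dual_ball_Y" "(1 / m) *\<^sub>R \<phi>2 \<in> dual_ball_Y"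
      using n m split by (auto simp: dual_ball_Y_def dual_Y_scaleR n_def m_def)
    have comb: "\<phi> = (1 - m) *\<^sub>R ((1 / n) *\<^sub>R \<phi>1) + m *\<^sub>R ((1 / m) *\<^sub>R \<phi>2)"
      using n m split(3) by (simp add: nm[symmetric])
    have "(1 / n) *\<^sub>R \<phi>1 = (1 / m) *\<^sub>R \<phi>2"
    proof (rule ccontr)
      assume "(1 / n) *\<^sub>R \<phi>1 \<noteq> (1 / m) *\<^sub>R \<phi>2"
      then have "\<phi> \<in> open_segment ((1 / n) *\<^sub>R \<phi>1) ((1 / m) *\<^sub>R \<phi>2)"
        unfolding in_segment using comb m n nm by (intro conjI exI[of _ m]) auto
      then show False using ext ball by (auto simp: extreme_point_of_def)
    qed
    with comb have eq: "\<phi> = (1 / n) *\<^sub>R \<phi>1"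
      by (simp only: scaleR_add_left[symmetric]) simp
    have "norm (blinfun_apply \<phi> F) \<le> sup_on A F" for F
    proof -
      have "norm (blinfun_apply \<phi> F) = norm (blinfun_apply \<phi>1 F) / n"
        using n by (simp add: eq blinfun.scaleR_left)
      also have "\<dots> \<le> sup_on A F"
        using bound[of F] n by (simp add: nm[unfolded m_def, symmetric] pos_divide_le_eq mult.commute)
      finally show ?thesis .
    qed
    then show ?thesis by blast
  qed
qed

text \<open>Induction with the two-set case. The empty family would force \<open>\<phi> = 0\<close>,
  against \<open>norm \<phi> = 1\<close>.\<close>

lemma extreme_sup_on_Union:
  assumes ext: "\<phi> extreme_point_of dual_ball_Y" and "finite \<A>"
    and "\<And>F. norm (blinfun_apply \<phi> F) \<le> sup_on (\<Union>\<A>) F"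
  shows "\<exists>A\<in>\<A>. \<forall>F. norm (blinfun_apply \<phi> F) \<le> sup_on A F"
  using assms(2,3)
proof (induction \<A>)
  case empty
  have "sup_on {} F \<le> 0" for F by (rule sup_on_least) auto
  then have "blinfun_apply \<phi> F = 0" for F 
    using empty[of F] order_trans[of _ "sup_on {} F" 0] by fastforce
  then have "\<phi> = 0" by (auto intro: blinfun_eqI)
  then show ?case using norm_extreme_eq_1[OF ext] by simp
next
  case (insert A \<A>)
  then show ?case using extreme_sup_on_Un[OF ext, of A "\<Union>\<A>"] by auto
qed

lemma extreme_kernel_point:
  assumes ext: "\<phi> extreme_point_of dual_ball_Y"
  obtains a where "a \<in> \<triangle>" "\<And>G. apply_Y G a = 0 \<Longrightarrow> blinfun_apply \<phi> G = 0"
proof (rule ccontr)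
  assume "\<not> thesis"
  then have "\<forall>a\<in>\<triangle>. \<exists>G. apply_Y G a = 0 \<and> blinfun_apply \<phi> G \<noteq> 0" using that by blast
  then obtain G where G: "\<And>a. a \<in> \<triangle> \<Longrightarrow> apply_Y (G a) a = 0"
      "\<And>a. a \<in> \<triangle> \<Longrightarrow> blinfun_apply \<phi> (G a) \<noteq> 0"
    by metis
  define V where "V H = {z \<in> \<triangle>. norm (apply_Y H z) < norm (blinfun_apply \<phi> H) / 2}" for H
  have openV: "open (V H)" for H
  proof -
    have "open (\<triangle> \<inter> (\<lambda>z. norm (apply_Y H z)) -` {..<norm (blinfun_apply \<phi> H) / 2})"
      by (intro continuous_open_preimage continuous_intros continuous_on_apply_Y) auto
    also have "\<dots> = V H" by (auto simp: V_def)
    finally show ?thesis .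
  qed
  \<comment> \<open>Testing on \<open>H\<close> itself suffices, since on \<open>V H\<close> its
    modulus is below half of \<open>norm (blinfun_apply \<phi> H)\<close>.\<close>
  have notV: "\<not> (\<forall>F. norm (blinfun_apply \<phi> F) \<le> sup_on (V H) F)" if "blinfun_apply \<phi> H \<noteq> 0" for H
  proof
    assume "\<forall>F. norm (blinfun_apply \<phi> F) \<le> sup_on (V H) F"
    then have "norm (blinfun_apply \<phi> H) \<le> sup_on (V H) H" by blast
    also have "\<dots> \<le> norm (blinfun_apply \<phi> H) / 2"
      by (rule sup_on_least) (auto simp: V_def)
    finally show False using that by simp
  qed
  have G0: "blinfun_apply \<phi> (G 0) \<noteq> 0" using G(2)[of 0] by simp
  \<comment> \<open>The disc is not compact, but \<open>V (G 0)\<close> contains all its points of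
    modulus above some \<open>r < 1\<close>; only \<open>cball 0 r\<close> is left to cover.\<close>
  have "(apply_Y (G 0) \<longlongrightarrow> 0) to_circle" using apply_Y_C0[of "G 0"] by (simp add: C0_disc_def)
  then have "\<forall>\<^sub>F z in to_circle. norm (apply_Y (G 0) z) < norm (blinfun_apply \<phi> (G 0)) / 2"
    using G0 by (intro order_tendstoD(2)[OF tendsto_norm_zero]) auto
  then obtain Q where "eventually Q (at_left (1::real))"
    and Q: "\<And>z. Q (norm z) \<Longrightarrow> norm (apply_Y (G 0) z) < norm (blinfun_apply \<phi> (G 0)) / 2"
    by (auto simp: eventually_filtercomap)
  then obtain r where r: "r < 1" "\<And>x. r < x \<Longrightarrow> x < 1 \<Longrightarrow> Q x"
    unfolding eventually_at_left_field by blast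
  have "z \<in> V (G z)" if "z \<in> cball 0 r" for z
    using that r(1) G[of z] by (auto simp: V_def)
  then have "cball 0 r \<subseteq> \<Union>((\<lambda>z. V (G z)) ` cball 0 r)" by blast
  then obtain D where D: "D \<subseteq> cball 0 r" "finite D" "cball 0 r \<subseteq> (\<Union>z\<in>D. V (G z))"
    using compactE_image[OF compact_cball, of "cball 0 r" "\<lambda>z. V (G z)" 0 r] openV by blast
  define \<A> where "\<A> = insert (V (G 0)) ((\<lambda>z. V (G z)) ` D)"
  have "\<triangle> \<subseteq> \<Union>\<A>"
  proof
    fix z :: complex assume z: "z \<in> \<triangle>"
    show "z \<in> \<Union>\<A>"
    proof (cases "norm z \<le> r")
      case True
      then show ?thesis using D(3) by (auto simp: \<A>_def)
    next
      case False
      then have "z \<in> V (G 0)" using z Q[OF r(2)[of "norm z"]] by (auto simp: V_def)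
      then show ?thesis by (simp add: \<A>_def)
    qed
  qed
  have "norm (blinfun_apply \<phi> F) \<le> sup_on (\<Union>\<A>) F" for F
  proof -
    have "norm (blinfun_apply \<phi> F) \<le> norm F"
      using ext by (auto simp: extreme_point_of_def intro: norm_dual_ball_apply)
    also have "\<dots> \<le> sup_on \<triangle> F" by (rule norm_le_sup_on_disc)
    also have "\<dots> \<le> sup_on (\<Union>\<A>) F" using \<open>\<triangle> \<subseteq> \<Union>\<A>\<close> by (rule sup_on_mono)
    finally show ?thesis .
  qed
  then obtain A where A: "A \<in> \<A>" "\<forall>F. norm (blinfun_apply \<phi> F) \<le> sup_on A F"
    using extreme_sup_on_Union[OF ext, of \<A>] D(2) by (auto simp: \<A>_def)
  have "z \<in> \<triangle>" if "z \<in> D" for z using that D(1) r(1) by fastforce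
  then obtain H where "A = V H" "blinfun_apply \<phi> H \<noteq> 0"
    using A(1) G(2) G0 unfolding \<A>_def by blast
  then show False using notV A(2) by blast
qed

theorem lemma2p1:
  shows "{\<phi>. \<phi> extreme_point_of dual_ball_Y}
    = {exp (\<i> * complex_of_real \<theta>) *\<^sub>D \<delta> z | z \<theta>. z \<in> \<triangle>}"
proof (intro equalityI subsetI)
  fix \<phi> assume "\<phi> \<in> {\<phi>. \<phi> extreme_point_of dual_ball_Y}"
  then have ext: "\<phi> extreme_point_of dual_ball_Y" by simp
  then have ball: "\<phi> \<in> dual_ball_Y" by (simp add: extreme_point_of_def)
  obtain a where a: "a \<in> \<triangle>" and ker: "\<And>G. apply_Y G a = 0 \<Longrightarrow> blinfun_apply \<phi> G = 0"
    using extreme_kernel_point[OF ext] by blast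
  obtain P where P: "apply_Y P a = 1" and normP: "norm P \<le> 1" using peak_in_Y[OF a] by blast
  define c where "c = blinfun_apply \<phi> P"
  have eq: "\<phi> = c *\<^sub>D \<delta> a"
    unfolding c_def using ball ker P by (intro dual_eq_scaleC_deltaI) (auto simp: dual_ball_Y_def)
  \<comment> \<open>The lower bound comes from \<open>norm \<phi> = 1\<close>, since
    \<open>\<delta> a\<close> has norm at most \<open>1\<close>; the upper one from the value at the
    peak function.\<close>
  have "1 \<le> norm c"
    using norm_extreme_eq_1[OF ext] norm_blinfun_bound[of "norm c" \<phi>]
    by (auto simp: eq norm_mult mult_left_mono norm_Y_ge)
  moreover have "norm c \<le> 1"
    using norm_dual_ball_apply[OF ball, of P] normP by (simp add: c_def)
  ultimately have "norm c = 1" by simp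
  then obtain t where "c = exp (\<i> * of_real t)" using complex_norm_eq_1_exp by metis
  with a eq show "\<phi> \<in> {exp (\<i> * complex_of_real \<theta>) *\<^sub>D \<delta> z | z \<theta>. z \<in> \<triangle>}" by blast
next
  fix \<phi> assume "\<phi> \<in> {exp (\<i> * complex_of_real \<theta>) *\<^sub>D \<delta> z | z \<theta>. z \<in> \<triangle>}"
  then show "\<phi> \<in> {\<phi>. \<phi> extreme_point_of dual_ball_Y}"
    by (auto intro!: scaleC_delta_extreme)
qed

end
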